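(* Let $a<b<c<d$ be real numbers and let $I=[a,b]\cup[c,d]$. Then the implication $$\Big(\exists\, C\in\mathbb{R}\ \ \forall\, t\in\mathbb{R}\quad \int_{I+t}f(x)\,dx=C\Big)\ \Longrightarrow\ f \text{ is constant}$$ does not hold for all continuous functions $f:\mathbb{R}\to\mathbb{R}$; that is, there exists a non-constant continuous function $f:\mathbb{R}\to\mathbb{R}$ whose integral over $I+t$ takes the same value for all $t\in\mathbb{R}$.
   Context: $I+t=\{x+t: x\in I\}$ denotes the image of $I$ under the translation by $t$. *)

theory Defs
  imports "HOL-Analysis.Analysis"
begin

end

theory Submission
  imports Defs
begin

text \<open>
  If \<open>F\<close> is an antiderivative of a continuous \<open>f\<close>, the integral of \<open>f\<close> over \<open>I + t\<close> is
  \<open>F (b + t) - F (a + t) + F (d + t) - F (c + t)\<close>. It is independent of \<open>t\<close> as soon as its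
  derivative vanishes, that is, as soon as \<open>f\<close> satisfies the difference equation
  \<open>f (b + t) - f (a + t) + f (d + t) - f (c + t) = 0\<close>
  (\<open>integral_over_translates_constant\<close>).

  This equation has a large space of continuous solutions. Its largest argument is \<open>d + t\<close>, so it
  can be read as a rule that computes \<open>f\<close> at a point from values at distance at least \<open>d - c\<close> to
  the left; its smallest argument is \<open>a + t\<close>, so it can equally be read as a rule that computes \<open>f\<close>
  from values at distance at least \<open>b - a\<close> to the right. Hence any continuous function on \<open>[a, d]\<close>
  satisfying the single instance \<open>t = 0\<close> extends uniquely, first to the right and then to the
  left, in steps of fixed positive length; the instance \<open>t = 0\<close> is what makes the pieces fit
  together continuously (\<open>continuous_delay_extension\<close>). Starting from a bump supported in \<open>[a, b]\<close>,
  which vanishes at all of \<open>a, b, c, d\<close>, yields a non-constant solution.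
\<close>

section \<open>Solving delay equations step by step\<close>

text \<open>
  The abstract method of steps. The operator \<open>A\<close> looks back by at least \<open>\<delta>\<close>: on \<open>{..y + \<delta>}\<close> its
  output depends only on its input on \<open>{..y}\<close>. Each application of \<open>A\<close> therefore fixes the
  solution on a further interval of length \<open>\<delta>\<close>, so the iterates are eventually constant on every
  half-line \<open>{..y}\<close> and their limit inherits continuity.
\<close>

lemma causal_continuous_extension:
  fixes A :: "(real \<Rightarrow> real) \<Rightarrow> real \<Rightarrow> real" and g :: "real \<Rightarrow> real"
  assumes "\<delta> > 0"
    and A_cont: "\<And>u. continuous_on UNIV u \<Longrightarrow> continuous_on UNIV (A u)"
    and causal: "\<And>u v y x. (\<And>z. z \<le> y \<Longrightarrow> u z = v z) \<Longrightarrow> x \<le> y + \<delta> \<Longrightarrow> A u x = A v x"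
    and g_cont: "continuous_on UNIV g"
    and fit: "A g x0 = g x0"
  obtains f where "continuous_on UNIV f" and "\<And>x. x \<le> x0 \<Longrightarrow> f x = g x"
    and "\<And>x. x \<ge> x0 \<Longrightarrow> f x = A f x"
proof -
  define h where "h n = ((\<lambda>u x. if x \<le> x0 then g x else A u x) ^^ n) g" for n
  have h_0: "h 0 = g"
    by (simp add: h_def)
  have h_Suc: "h (Suc n) = (\<lambda>x. if x \<le> x0 then g x else A (h n) x)" for n
    unfolding h_def by simp
  have h_left: "h n x = g x" if "x \<le> x0" for n x
    using that by (cases n) (simp_all add: h_0 h_Suc)
  have A_x0: "A u x0 = g x0" if "\<And>x. x \<le> x0 \<Longrightarrow> u x = g x" for u
    using causal[of x0 u g x0] that fit \<open>\<delta> > 0\<close> by auto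
  have h_cont: "continuous_on UNIV (h n)" for n
  proof (induction n)
    case 0
    show ?case using g_cont by (simp add: h_0)
  next
    case (Suc n)
    have "continuous_on ({..x0} \<union> {x0..}) (\<lambda>x. if x \<le> x0 then g x else A (h n) x)"
    proof (rule continuous_on_If)
      show "continuous_on {..x0} g" "continuous_on {x0..} (A (h n))"
        using g_cont A_cont[OF Suc] continuous_on_subset by blast+
      fix x assume "x \<in> {x0..}" "x \<le> x0"
      then show "g x = A (h n) x" using A_x0[of "h n"] h_left by simp
    qed auto
    moreover have "{..x0} \<union> {x0..} = UNIV" by auto
    ultimately show ?case by (simp add: h_Suc)
  qed
  have stable_Suc: "h (Suc n) x = h n x" if "x \<le> x0 + of_nat n * \<delta>" for n x
    using that
  proof (induction n arbitrary: x)
    case 0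
    then show ?case by (simp add: h_0 h_left)
  next
    case (Suc n)
    have "A (h (Suc n)) x = A (h n) x"
      by (rule causal[of "x0 + of_nat n * \<delta>"]) (use Suc in \<open>auto simp: algebra_simps\<close>)
    then show ?case by (simp add: h_Suc)
  qed
  have stable: "h n x = h m x" if "m \<le> n" "x \<le> x0 + of_nat m * \<delta>" for m n x
    using that(1)
  proof (induction n rule: dec_induct)
    case base
    show ?case ..
  next
    case (step n)
    have "of_nat m * \<delta> \<le> of_nat n * \<delta>"
      using step \<open>\<delta> > 0\<close> by (intro mult_right_mono) auto
    then show ?case using step stable_Suc[of x n] that(2) by simp
  qed
  define N where "N x = nat \<lceil>(x - x0) / \<delta>\<rceil>" for x
  define f where "f x = h (N x) x" for x
  have N_bound: "x \<le> x0 + of_nat (N x) * \<delta>" for x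
  proof -
    have "(x - x0) / \<delta> \<le> of_nat (N x)"
      unfolding N_def by (rule real_nat_ceiling_ge)
    then show ?thesis using \<open>\<delta> > 0\<close> by (simp add: field_simps)
  qed
  have f_eq_h: "f x = h n x" if "x \<le> x0 + of_nat n * \<delta>" for n x
  proof -
    have "(x - x0) / \<delta> \<le> of_nat n"
      using that \<open>\<delta> > 0\<close> by (simp add: field_simps)
    then have "N x \<le> n" unfolding N_def by (simp add: nat_le_iff ceiling_le_iff)
    then show ?thesis using stable N_bound unfolding f_def by simp
  qed
  show thesis
  proof
    show "continuous_on UNIV f"
      unfolding continuous_on_eq_continuous_at[OF open_UNIV]
    proof
      fix x
      define n where "n = Suc (N x)"
      have "x < x0 + of_nat n * \<delta>"
        using N_bound[of x] \<open>\<delta> > 0\<close> by (simp add: n_def algebra_simps)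
      then have "\<forall>\<^sub>F y in nhds x. y < x0 + of_nat n * \<delta>"
        by (intro eventually_nhds_in_open[of "{..<_}", simplified]) auto
      then have "\<forall>\<^sub>F y in nhds x. f y = h n y"
        by eventually_elim (simp add: f_eq_h)
      moreover have "isCont (h n) x"
        using h_cont continuous_on_eq_continuous_at by blast
      ultimately show "isCont f x"
        using isCont_cong by blast
    qed
    show f_left: "f x = g x" if "x \<le> x0" for x
      using that by (simp add: f_def h_left)
    show "f x = A f x" if "x \<ge> x0" for x
    proof (cases "x = x0")
      case True
      then show ?thesis using A_x0[of f] f_left by simp
    next
      case False
      let ?n = "N x"
      have "f x = h (Suc ?n) x"
        using stable_Suc[OF N_bound] by (simp add: f_def)
      also have "\<dots> = A (h ?n) x"
        using that False by (simp add: h_Suc)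
      also have "\<dots> = A f x"
        by (rule causal[of "x0 + of_nat ?n * \<delta>"])
          (use f_eq_h N_bound[of x] \<open>\<delta> > 0\<close> in auto)
      finally show ?thesis .
    qed
  qed
qed

lemma continuous_delay_extension:
  fixes g :: "real \<Rightarrow> real"
  assumes "p > 0" "q > 0" "r > 0"
    and g_cont: "continuous_on UNIV g"
    and fit: "g x0 = g (x0 - p) - g (x0 - q) + g (x0 - r)"
  obtains f where "continuous_on UNIV f" and "\<And>x. x \<le> x0 \<Longrightarrow> f x = g x"
    and "\<And>x. x \<ge> x0 \<Longrightarrow> f x = f (x - p) - f (x - q) + f (x - r)"
proof -
  define A where "A u x = u (x - p) - u (x - q) + u (x - r)" for u :: "real \<Rightarrow> real" and x
  have shift: "continuous_on UNIV (\<lambda>x. u (x - s))"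
    if "continuous_on UNIV u" for u :: "real \<Rightarrow> real" and s
    by (rule continuous_on_compose2[OF that]) (auto intro!: continuous_intros)
  show thesis
  proof (rule causal_continuous_extension[of "min p (min q r)" A g x0])
    show "continuous_on UNIV (A u)" if "continuous_on UNIV u" for u
      unfolding A_def using that by (intro continuous_intros shift)
    show "A u x = A v x"
      if "\<And>z. z \<le> y \<Longrightarrow> u z = v z" "x \<le> y + min p (min q r)" for u v y x
      using that by (simp add: A_def)
  qed (use assms that in \<open>auto simp: A_def\<close>)
qed

section \<open>Integrals over the translates of two intervals\<close>

lemma integral_over_translates_constant:
  fixes f :: "real \<Rightarrow> real"
  assumes "a \<le> b" "b < c" "c \<le> d"
    and f_cont: "continuous_on UNIV f"
    and eq: "\<And>t. f (b + t) - f (a + t) + f (d + t) - f (c + t) = 0"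
  shows "\<exists>C. \<forall>t. (f has_integral C) ((\<lambda>x. x + t) ` ({a..b} \<union> {c..d}))"
proof -
  have "\<exists>F. \<forall>x::real. -\<infinity> < ereal x \<longrightarrow> ereal x < \<infinity> \<longrightarrow> (F has_vector_derivative f x) (at x)"
    by (rule einterval_antiderivative)
      (use f_cont in \<open>auto simp: continuous_on_eq_continuous_at\<close>)
  then obtain F where F: "(F has_real_derivative f x) (at x)" for x
    by (auto simp: has_real_derivative_iff_has_vector_derivative)
  define J where "J t = F (b + t) - F (a + t) + (F (d + t) - F (c + t))" for t
  have "(J has_real_derivative 0) (at t)" for t
  proof -
    have F_shift: "((\<lambda>t. F (s + t)) has_real_derivative f (s + t)) (at t)" for s
      using F[of "s + t"] DERIV_shift[of F "f (s + t)" t s] by (simp add: add.commute)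
    have "(J has_real_derivative f (b + t) - f (a + t) + (f (d + t) - f (c + t))) (at t)"
      unfolding J_def by (intro derivative_intros F_shift)
    then show ?thesis using eq[of t] by (simp add: algebra_simps)
  qed
  then have "\<forall>t. (J has_real_derivative 0) (at t)" ..
  then have J_const: "J t = J 0" for t
    by (rule DERIV_isconst_all)
  have FTC: "(f has_integral F v - F u) {u..v}" if "u \<le> v" for u v
    using that F
    by (intro fundamental_theorem_of_calculus)
      (auto simp: has_real_derivative_iff_has_vector_derivative
            intro: has_vector_derivative_at_within)
  have "(f has_integral J 0) ((\<lambda>x. x + t) ` ({a..b} \<union> {c..d}))" for t
  proof -
    have "{a + t..b + t} \<inter> {c + t..d + t} = {}"
      using assms(2) by auto
    then have "(f has_integral J t) ({a + t..b + t} \<union> {c + t..d + t})"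
      unfolding J_def using assms by (intro has_integral_Un FTC) auto
    then show ?thesis by (simp add: J_const[of t] image_Un)
  qed
  then show ?thesis by blast
qed

section \<open>A non-constant solution\<close>

theorem proposition2p3:
  fixes a b c d :: real
  assumes "a < b" and "b < c" and "c < d"
  shows "\<exists>f :: real \<Rightarrow> real.
           continuous_on UNIV f \<and>
           (\<exists>C. \<forall>t. (f has_integral C) ((\<lambda>x. x + t) ` ({a..b} \<union> {c..d}))) \<and>
           \<not> f constant_on UNIV"
proof -
  define bump where "bump x = max 0 (min (x - a) (b - x))" for x
  have bump_cont: "continuous_on UNIV bump"
    unfolding bump_def by (intro continuous_intros)
  have bump_0: "bump a = 0" "bump b = 0" "bump c = 0" "bump d = 0"
    using assms by (auto simp: bump_def)
  have "bump d = bump (d - (d - c)) - bump (d - (d - b)) + bump (d - (d - a))"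
    by (simp add: bump_0)
  then obtain g where g_cont: "continuous_on UNIV g"
    and g_bump: "\<And>x. x \<le> d \<Longrightarrow> g x = bump x"
    and g_eq: "\<And>x. x \<ge> d \<Longrightarrow> g x = g (x - (d - c)) - g (x - (d - b)) + g (x - (d - a))"
    using continuous_delay_extension[of "d - c" "d - b" "d - a" bump d] bump_cont assms by auto
  \<comment> \<open>Extending to the left amounts to extending the reflected function to the right. Its delays are the
    distances from \<open>a\<close>, and the equation solved for its value at \<open>a + t\<close> has the same signs.\<close>
  define k where "k x = g (- x)" for x
  have k_cont: "continuous_on UNIV k"
    unfolding k_def by (rule continuous_on_compose2[OF g_cont]) (auto intro!: continuous_intros)
  have "k (- a) = k (- a - (b - a)) - k (- a - (c - a)) + k (- a - (d - a))"
    using assms by (simp add: k_def g_bump bump_0)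
  then obtain l where l_cont: "continuous_on UNIV l"
    and l_k: "\<And>x. x \<le> - a \<Longrightarrow> l x = k x"
    and l_eq: "\<And>x. x \<ge> - a \<Longrightarrow> l x = l (x - (b - a)) - l (x - (c - a)) + l (x - (d - a))"
    using continuous_delay_extension[of "b - a" "c - a" "d - a" k "- a"] k_cont assms by auto
  define f where "f x = l (- x)" for x
  have f_cont: "continuous_on UNIV f"
    unfolding f_def by (rule continuous_on_compose2[OF l_cont]) (auto intro!: continuous_intros)
  have f_g: "f x = g x" if "x \<ge> a" for x
    using that by (simp add: f_def l_k k_def)
  have "f (b + t) - f (a + t) + f (d + t) - f (c + t) = 0" for t
  proof (cases "t \<ge> 0")
    case True
    then show ?thesis
      using g_eq[of "d + t"] assms by (simp add: f_g algebra_simps)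
  next
    case False
    have "- (a + t) - (s - a) = - (s + t)" for s
      by simp
    moreover have "- a \<le> - (a + t)"
      using False by simp
    ultimately have "l (- (a + t)) = l (- (b + t)) - l (- (c + t)) + l (- (d + t))"
      using l_eq[of "- (a + t)"] by presburger
    then show ?thesis unfolding f_def by linarith
  qed
  then have "\<exists>C. \<forall>t. (f has_integral C) ((\<lambda>x. x + t) ` ({a..b} \<union> {c..d}))"
    using assms f_cont by (intro integral_over_translates_constant) auto
  moreover have "\<not> f constant_on UNIV"
  proof
    assume "f constant_on UNIV"
    then have "f ((a + b) / 2) = f b" by (auto simp: constant_on_def)
    moreover have "f ((a + b) / 2) = bump ((a + b) / 2)" "f b = 0"
      using assms by (simp_all add: f_g g_bump bump_0)
    ultimately show False using assms by (simp add: bump_def max_def min_def field_simps split: if_splits)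
  qed
  ultimately show ?thesis using f_cont by blast
qed

end
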